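(* Let $\{X_{k,n},\ 1\le k\le k(n)\}_{n\ge1}$ be an array of real-valued, centered and square integrable random variables, with $k(n)\to+\infty$, such that for each $n$ the variables $X_{1,n},\dots,X_{k(n),n}$ are independent, and put $S_n=X_{1,n}+\cdots+X_{k(n),n}$. Let $F_{k,n}$ be the cumulative distribution function of $X_{k,n}$. Suppose that for all $n\ge1$ $$\sum_{1\le k\le k(n)}\mathrm{Var}(X_{k,n})=1 .$$ For $\varepsilon>0$ and $n\ge1$ let $$g_n(\varepsilon)=\sum_{k=1}^{k(n)}\int_{(|x|\ge\varepsilon)}x^2\,dF_{k,n}(x).$$ Then both $$S_n\rightsquigarrow\mathcal N(0,1)\ \text{ as } n\to+\infty\qquad\text{and}\qquad \max_{1\le k\le k(n)}\mathrm{Var}(X_{k,n})\to0\ \text{ as } n\to+\infty$$ hold if and only if, for every $\varepsilon>0$, $g_n(\varepsilon)\to0$ as $n\to+\infty$.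
   Context: $\rightsquigarrow$ denotes convergence in distribution; $\mathcal N(0,1)$ is the standard Gaussian law. *)

theory Defs
  imports "HOL-Probability.Probability"
begin

end

theory Submission
  imports Defs
begin

text \<open>
  Write \<open>\<phi>\<^sub>k\<close> for the characteristic function of the \<open>k\<close>-th summand of a row, \<open>v\<^sub>k\<close> for its variance and
  \<open>g(\<epsilon>)\<close> for the truncated second moments summed over the row. The row sum has characteristic
  function \<open>\<Prod>\<^sub>k \<phi>\<^sub>k\<close>. Each \<open>\<phi>\<^sub>k - 1\<close> is of order \<open>t\<^sup>2 v\<^sub>k\<close> and \<open>\<phi>\<^sub>k - exp (\<phi>\<^sub>k - 1)\<close> is of the order of its
  square, so when the largest variance tends to 0 the product may be replaced by
  \<open>exp (\<Sum>\<^sub>k (\<phi>\<^sub>k - 1))\<close>, the characteristic function of the accompanying compound Poisson law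
  (\<open>char_sum_accompanying_bound\<close>). This turns the limit theorem into a question about the sum
  \<open>\<psi> = \<Sum>\<^sub>k (\<phi>\<^sub>k - 1)\<close>. As the variances add up to 1,
  \<open>\<psi> + t\<^sup>2/2\<close> is the sum of the errors that the second order expansions of the \<open>\<phi>\<^sub>k\<close> make.

  If \<open>g(\<epsilon>) \<rightarrow> 0\<close> for every \<open>\<epsilon>\<close>, the largest variance is at most \<open>\<epsilon>\<^sup>2 + g(\<epsilon>)\<close>
  (\<open>second_moment_le_tail\<close>) and the total error is at most
  \<open>\<bar>t\<bar>\<^sup>3 \<epsilon>/6 + t\<^sup>2 g(\<epsilon>)\<close> (\<open>char_second_order_tail_bound\<close>). Both tend to 0, and Levy's
  continuity theorem gives the normal limit.

  Conversely, a normal limit together with vanishing variances gives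
  \<open>exp \<psi> \<rightarrow> exp (-t\<^sup>2/2)\<close>. Taking moduli gives \<open>Re \<psi> + t\<^sup>2/2 \<rightarrow> 0\<close>, which avoids any choice of a
  complex logarithm. The left-hand side is a sum of expectations of the nonnegative function
  \<open>cos (t x) - 1 + t\<^sup>2 x\<^sup>2/2\<close>. For \<open>\<bar>x\<bar> \<ge> \<epsilon>\<close> the cosine cannot compensate the quadratic term
  once \<open>t > 2/\<epsilon>\<close>, so the sum dominates a positive multiple of \<open>g(\<epsilon>)\<close>
  (\<open>tail_le_char_deviation\<close>).
\<close>

section \<open>Analytic preliminaries\<close>

lemma one_minus_cos_le:
  fixes y :: real
  shows "1 - cos y \<le> y\<^sup>2 / 2"
proof -
  have "1 - cos y = 2 * (sin (y / 2))\<^sup>2"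
    using cos_double_sin[of "y / 2"] by simp
  moreover have "(sin (y / 2))\<^sup>2 \<le> (y / 2)\<^sup>2"
    using abs_sin_x_le_abs_x[of "y / 2"] by (simp only: abs_le_square_iff)
  ultimately show ?thesis
    by (simp add: power_divide)
qed

text \<open>
  Both consequences of the Lindeberg condition have this form: a bound for each truncation level
  \<open>\<epsilon>\<close>, in which the limit along the filter comes first and \<open>\<epsilon> \<rightarrow> 0\<close> second.
\<close>

lemma tendsto_zero_by_approximation:
  fixes f :: "'i \<Rightarrow> 'b::real_normed_vector" and h :: "real \<Rightarrow> real" and g :: "'i \<Rightarrow> real \<Rightarrow> real"
  assumes g: "\<And>\<epsilon>. \<epsilon> > 0 \<Longrightarrow> ((\<lambda>n. g n \<epsilon>) \<longlongrightarrow> 0) F"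
    and h: "(h \<longlongrightarrow> 0) (at_right 0)"
    and bound: "\<And>n \<epsilon>. \<epsilon> > 0 \<Longrightarrow> norm (f n) \<le> h \<epsilon> + C * g n \<epsilon>"
  shows "(f \<longlongrightarrow> 0) F"
proof (rule tendstoI)
  fix \<delta> :: real
  assume "\<delta> > 0"
  then have "\<forall>\<^sub>F \<epsilon> in at_right 0. h \<epsilon> < \<delta> / 2"
    using h by (intro order_tendstoD(2)) auto
  moreover have "\<forall>\<^sub>F \<epsilon> in at_right 0. (0::real) < \<epsilon>"
    by (simp add: eventually_at_right_less)
  ultimately have "\<forall>\<^sub>F \<epsilon> in at_right 0. h \<epsilon> < \<delta> / 2 \<and> \<epsilon> > 0"
    by (rule eventually_conj)
  then obtain \<epsilon> where \<epsilon>: "\<epsilon> > 0" "h \<epsilon> < \<delta> / 2"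
    using eventually_happens'[OF trivial_limit_at_right_real] by blast
  have "((\<lambda>n. C * g n \<epsilon>) \<longlongrightarrow> 0) F"
    using tendsto_mult_left[OF g[OF \<epsilon>(1)], of C] by simp
  then have "\<forall>\<^sub>F n in F. C * g n \<epsilon> < \<delta> / 2"
    using \<open>\<delta> > 0\<close> by (intro order_tendstoD(2)) auto
  then show "\<forall>\<^sub>F n in F. dist (f n) 0 < \<delta>"
  proof eventually_elim
    case (elim n)
    then show ?case
      using bound[OF \<epsilon>(1), of n] \<epsilon>(2) by simp
  qed
qed

section \<open>Truncated second moments\<close>

definition tail_second_moment :: "'a measure \<Rightarrow> ('a \<Rightarrow> real) \<Rightarrow> real \<Rightarrow> real" where
  "tail_second_moment M X \<epsilon> = (LINT \<omega>:{\<omega>. \<epsilon> \<le> \<bar>X \<omega>\<bar>}|M. (X \<omega>)\<^sup>2)"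

context prob_space
begin

lemma
  assumes [measurable]: "random_variable borel X"
    and sq: "integrable M (\<lambda>\<omega>. (X \<omega>)\<^sup>2)"
  shows integrable_tail_square: "integrable M (\<lambda>\<omega>. indicator {\<omega>. \<epsilon> \<le> \<bar>X \<omega>\<bar>} \<omega> * (X \<omega>)\<^sup>2)"
    and tail_second_moment_nonneg: "0 \<le> tail_second_moment M X \<epsilon>"
    and second_moment_le_tail: "expectation (\<lambda>\<omega>. (X \<omega>)\<^sup>2) \<le> \<epsilon>\<^sup>2 + tail_second_moment M X \<epsilon>"
proof -
  show int: "integrable M (\<lambda>\<omega>. indicator {\<omega>. \<epsilon> \<le> \<bar>X \<omega>\<bar>} \<omega> * (X \<omega>)\<^sup>2)"
    by (rule Bochner_Integration.integrable_bound[OF sq]) (auto simp: indicator_def)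
  show "0 \<le> tail_second_moment M X \<epsilon>"
    unfolding tail_second_moment_def set_lebesgue_integral_def
    by (intro integral_nonneg_AE) (auto simp: indicator_def)
  have "expectation (\<lambda>\<omega>. (X \<omega>)\<^sup>2) \<le>
      expectation (\<lambda>\<omega>. \<epsilon>\<^sup>2 + indicator {\<omega>. \<epsilon> \<le> \<bar>X \<omega>\<bar>} \<omega> * (X \<omega>)\<^sup>2)"
  proof (rule integral_mono[OF sq])
    show "integrable M (\<lambda>\<omega>. \<epsilon>\<^sup>2 + indicator {\<omega>. \<epsilon> \<le> \<bar>X \<omega>\<bar>} \<omega> * (X \<omega>)\<^sup>2)"
      using int by simp
    show "(X \<omega>)\<^sup>2 \<le> \<epsilon>\<^sup>2 + indicator {\<omega>. \<epsilon> \<le> \<bar>X \<omega>\<bar>} \<omega> * (X \<omega>)\<^sup>2" for \<omega>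
      by (cases "\<epsilon> \<le> \<bar>X \<omega>\<bar>") (auto simp: abs_le_square_iff[symmetric])
  qed
  also have "\<dots> = \<epsilon>\<^sup>2 + tail_second_moment M X \<epsilon>"
    unfolding tail_second_moment_def set_lebesgue_integral_def
    using int by (simp add: prob_space)
  finally show "expectation (\<lambda>\<omega>. (X \<omega>)\<^sup>2) \<le> \<epsilon>\<^sup>2 + tail_second_moment M X \<epsilon>" .
qed

text \<open>
  A distribution function determines its law, so the Stieltjes measure it generates is the law of
  \<open>X\<close> again, and integration against it is an expectation.
\<close>

lemma tail_second_moment_eq_interval_measure:
  assumes X[measurable]: "random_variable borel X"
  shows "(LINT x:{x. \<bar>x\<bar> \<ge> \<epsilon>}|interval_measure (cdf (distr M borel X)). x\<^sup>2) = tail_second_moment M X \<epsilon>"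
proof -
  interpret D: real_distribution "distr M borel X"
    by (rule real_distribution_distr) fact
  have [simp]: "interval_measure (cdf (distr M borel X)) = distr M borel X"
    by (intro cdf_unique real_distribution_interval_measure cdf_interval_measure
          D.real_distribution_axioms D.cdf_nondecreasing D.cdf_is_right_cont
          D.cdf_lim_at_bot D.cdf_lim_at_top_prob)
  show ?thesis
    unfolding tail_second_moment_def set_lebesgue_integral_def
    by (simp add: integral_distr indicator_def)
qed

section \<open>Characteristic functions of a single summand\<close>

text \<open>
  The Taylor error of \<open>exp (\<i>tX)\<close> at order two is bounded both by a cubic and by a quadratic
  expression in \<open>X\<close>. Where \<open>\<bar>X\<bar> < \<epsilon>\<close> the cubic one gains a factor \<open>\<epsilon>\<close> over \<open>X\<^sup>2\<close>; elsewhere the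
  quadratic one contributes only the truncated second moment.
\<close>

lemma char_second_order_tail_bound:
  assumes X[measurable]: "random_variable borel X"
    and sq: "integrable M (\<lambda>\<omega>. (X \<omega>)\<^sup>2)"
    and mean: "expectation X = 0"
    and \<epsilon>: "\<epsilon> > 0"
  defines "v \<equiv> expectation (\<lambda>\<omega>. (X \<omega>)\<^sup>2)"
  shows "cmod (char (distr M borel X) t - 1 + complex_of_real (t\<^sup>2 * v / 2))
    \<le> \<bar>t\<bar> ^ 3 * \<epsilon> / 6 * v + t\<^sup>2 * tail_second_moment M X \<epsilon>"
proof -
  have int: "integrable M X"
    by (rule square_integrable_imp_integrable[OF X sq])
  have "cmod (char (distr M borel X) t - (1 - complex_of_real (t\<^sup>2 * v / 2)))
      \<le> t\<^sup>2 / 6 * expectation (\<lambda>\<omega>. min (6 * (X \<omega>)\<^sup>2) (\<bar>t\<bar> * \<bar>X \<omega>\<bar> ^ 3))"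
    using char_approx3'[OF X int sq mean _ refl, of v t] mean by (simp add: v_def)
  also have "\<dots> \<le> t\<^sup>2 / 6 * expectation (\<lambda>\<omega>. \<bar>t\<bar> * \<epsilon> * (X \<omega>)\<^sup>2
      + 6 * (indicator {\<omega>. \<epsilon> \<le> \<bar>X \<omega>\<bar>} \<omega> * (X \<omega>)\<^sup>2))"
  proof (intro mult_left_mono integral_mono)
    show "integrable M (\<lambda>\<omega>. min (6 * (X \<omega>)\<^sup>2) (\<bar>t\<bar> * \<bar>X \<omega>\<bar> ^ 3))"
      by (rule Bochner_Integration.integrable_bound[OF integrable_mult_right[OF sq, of 6]]) auto
    show "integrable M (\<lambda>\<omega>. \<bar>t\<bar> * \<epsilon> * (X \<omega>)\<^sup>2 + 6 * (indicator {\<omega>. \<epsilon> \<le> \<bar>X \<omega>\<bar>} \<omega> * (X \<omega>)\<^sup>2))"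
      using integrable_tail_square[OF X sq] sq by auto
    show "min (6 * (X \<omega>)\<^sup>2) (\<bar>t\<bar> * \<bar>X \<omega>\<bar> ^ 3)
      \<le> \<bar>t\<bar> * \<epsilon> * (X \<omega>)\<^sup>2 + 6 * (indicator {\<omega>. \<epsilon> \<le> \<bar>X \<omega>\<bar>} \<omega> * (X \<omega>)\<^sup>2)" for \<omega>
    proof (cases "\<epsilon> \<le> \<bar>X \<omega>\<bar>")
      case True
      have "0 \<le> \<bar>t\<bar> * \<epsilon> * (X \<omega>)\<^sup>2"
        using \<epsilon> by simp
      then show ?thesis
        using True by (intro min.coboundedI1) simp
    next
      case False
      then have "\<bar>t\<bar> * (\<bar>X \<omega>\<bar> * (X \<omega>)\<^sup>2) \<le> \<bar>t\<bar> * (\<epsilon> * (X \<omega>)\<^sup>2)"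
        by (intro mult_left_mono mult_right_mono) auto
      then show ?thesis
        using False by (simp add: power3_eq_cube power2_eq_square min.coboundedI2 abs_mult mult.assoc)
    qed
  qed simp
  also have "\<dots> = t\<^sup>2 / 6 * (\<bar>t\<bar> * \<epsilon> * v + 6 * tail_second_moment M X \<epsilon>)"
    unfolding tail_second_moment_def set_lebesgue_integral_def v_def
    using integrable_tail_square[OF X sq] sq by simp
  also have "\<dots> = t\<^sup>2 * \<bar>t\<bar> * \<epsilon> / 6 * v + t\<^sup>2 * tail_second_moment M X \<epsilon>"
    by (simp add: algebra_simps)
  also have "t\<^sup>2 * \<bar>t\<bar> = \<bar>t\<bar> ^ 3"
    by (simp add: power3_eq_cube power2_eq_square)
  finally show ?thesis
    by (simp add: algebra_simps)
qed

text \<open>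
  The right-hand side is the expectation of \<open>cos (tX) - 1 + t\<^sup>2X\<^sup>2/2\<close>, which is nonnegative. Where
  \<open>\<bar>X\<bar> \<ge> \<epsilon>\<close>, the estimate \<open>1 - cos (tX) \<le> 2 \<le> 2X\<^sup>2/\<epsilon>\<^sup>2\<close> leaves at least the
  multiple \<open>t\<^sup>2/2 - 2/\<epsilon>\<^sup>2\<close> of \<open>X\<^sup>2\<close>. This recovers the truncated second
  moment from the characteristic function as soon as that multiple is positive.
\<close>

lemma tail_le_char_deviation:
  assumes X[measurable]: "random_variable borel X"
    and sq: "integrable M (\<lambda>\<omega>. (X \<omega>)\<^sup>2)"
    and \<epsilon>: "\<epsilon> > 0"
  shows "(t\<^sup>2 / 2 - 2 / \<epsilon>\<^sup>2) * tail_second_moment M X \<epsilon>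
    \<le> Re (char (distr M borel X) t) - 1 + t\<^sup>2 * expectation (\<lambda>\<omega>. (X \<omega>)\<^sup>2) / 2"
proof -
  have int_exp: "integrable M (\<lambda>\<omega>. iexp (t * X \<omega>))"
    by (rule integrable_const_bound[where B=1]) auto
  have int_cos: "integrable M (\<lambda>\<omega>. cos (t * X \<omega>))"
    by (rule integrable_const_bound[where B=1]) auto
  have "Re (char (distr M borel X) t) = expectation (\<lambda>\<omega>. cos (t * X \<omega>))"
    using integral_Re[OF int_exp] by (simp add: char_def integral_distr Re_exp)
  have "(t\<^sup>2 / 2 - 2 / \<epsilon>\<^sup>2) * tail_second_moment M X \<epsilon>
     = expectation (\<lambda>\<omega>. (t\<^sup>2 / 2 - 2 / \<epsilon>\<^sup>2) * (indicator {\<omega>. \<epsilon> \<le> \<bar>X \<omega>\<bar>} \<omega> * (X \<omega>)\<^sup>2))"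
    unfolding tail_second_moment_def set_lebesgue_integral_def by simp
  also have "\<dots> \<le> expectation (\<lambda>\<omega>. cos (t * X \<omega>) - 1 + t\<^sup>2 / 2 * (X \<omega>)\<^sup>2)"
  proof (rule integral_mono)
    show "integrable M (\<lambda>\<omega>. (t\<^sup>2 / 2 - 2 / \<epsilon>\<^sup>2) * (indicator {\<omega>. \<epsilon> \<le> \<bar>X \<omega>\<bar>} \<omega> * (X \<omega>)\<^sup>2))"
      by (intro integrable_mult_right integrable_tail_square X sq)
    show "integrable M (\<lambda>\<omega>. cos (t * X \<omega>) - 1 + t\<^sup>2 / 2 * (X \<omega>)\<^sup>2)"
      using int_cos sq by simp
    show "(t\<^sup>2 / 2 - 2 / \<epsilon>\<^sup>2) * (indicator {\<omega>. \<epsilon> \<le> \<bar>X \<omega>\<bar>} \<omega> * (X \<omega>)\<^sup>2)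
      \<le> cos (t * X \<omega>) - 1 + t\<^sup>2 / 2 * (X \<omega>)\<^sup>2" for \<omega>
    proof (cases "\<epsilon> \<le> \<bar>X \<omega>\<bar>")
      case True
      then have "\<epsilon>\<^sup>2 \<le> (X \<omega>)\<^sup>2"
        using \<epsilon> by (simp add: abs_le_square_iff[symmetric])
      then have "1 \<le> (X \<omega>)\<^sup>2 / \<epsilon>\<^sup>2"
        using \<epsilon> by simp
      moreover have "cos (t * X \<omega>) \<ge> -1"
        by simp
      ultimately have "- (2 * ((X \<omega>)\<^sup>2 / \<epsilon>\<^sup>2)) \<le> cos (t * X \<omega>) - 1"
        by linarith
      then show ?thesis
        using True by (simp add: algebra_simps)
    next
      case False
      then show ?thesis
        using one_minus_cos_le[of "t * X \<omega>"] by (simp add: power_mult_distrib)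
    qed
  qed
  also have "\<dots> = expectation (\<lambda>\<omega>. cos (t * X \<omega>)) - 1 + t\<^sup>2 / 2 * expectation (\<lambda>\<omega>. (X \<omega>)\<^sup>2)"
    using int_cos sq by (simp add: prob_space)
  finally show ?thesis
    using \<open>Re _ = _\<close> by simp
qed

lemma char_minus_one_bound:
  assumes X[measurable]: "random_variable borel X"
    and sq: "integrable M (\<lambda>\<omega>. (X \<omega>)\<^sup>2)"
    and mean: "expectation X = 0"
  shows "cmod (char (distr M borel X) t - 1) \<le> 2 * t\<^sup>2 * expectation (\<lambda>\<omega>. (X \<omega>)\<^sup>2)"
proof -
  let ?v = "expectation (\<lambda>\<omega>. (X \<omega>)\<^sup>2)"
  have int: "integrable M X"
    by (rule square_integrable_imp_integrable[OF X sq])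
  have v: "0 \<le> ?v"
    by simp
  have "cmod (char (distr M borel X) t - (1 - complex_of_real (t\<^sup>2 * ?v / 2)))
      \<le> t\<^sup>2 / 6 * expectation (\<lambda>\<omega>. min (6 * (X \<omega>)\<^sup>2) (\<bar>t\<bar> * \<bar>X \<omega>\<bar> ^ 3))"
    using char_approx3'[OF X int sq mean _ refl, of ?v t] mean by simp
  also have "\<dots> \<le> t\<^sup>2 / 6 * expectation (\<lambda>\<omega>. 6 * (X \<omega>)\<^sup>2)"
    by (intro mult_left_mono integral_mono
          Bochner_Integration.integrable_bound[OF integrable_mult_right[OF sq, of 6]]
          integrable_mult_right sq) auto
  also have "\<dots> = t\<^sup>2 * ?v"
    by simp
  finally have A: "cmod (char (distr M borel X) t - (1 - complex_of_real (t\<^sup>2 * ?v / 2))) \<le> t\<^sup>2 * ?v" .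
  have "cmod (char (distr M borel X) t - 1) \<le>
      cmod (char (distr M borel X) t - (1 - complex_of_real (t\<^sup>2 * ?v / 2)))
      + cmod (complex_of_real (t\<^sup>2 * ?v / 2))"
    using norm_triangle_ineq4[of "char (distr M borel X) t - (1 - complex_of_real (t\<^sup>2 * ?v / 2))"
        "complex_of_real (t\<^sup>2 * ?v / 2)"] by simp
  also have "cmod (complex_of_real (t\<^sup>2 * ?v / 2)) = t\<^sup>2 * ?v / 2"
    unfolding norm_of_real using v by simp
  finally show ?thesis
    using A mult_nonneg_nonneg[OF zero_le_power2 v, of t] by linarith
qed

section \<open>Comparison of the row sum with its accompanying law\<close>

text \<open>
  All factors \<open>\<phi>\<^sub>k\<close> and \<open>exp (\<phi>\<^sub>k - 1)\<close> lie in the unit disc, so the two products differ by at most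
  the sum of the differences of their factors. Each difference is quadratic in \<open>\<phi>\<^sub>k - 1\<close>, hence at
  most a constant times \<open>v\<^sub>k\<^sup>2\<close>, and bounding one factor \<open>v\<^sub>k\<close> by \<open>m\<close> leaves an expression that is
  small with the largest variance. The constant \<open>exp 2\<close> comes from
  \<open>\<bar>Re (\<phi>\<^sub>k - 1)\<bar> \<le> 2\<close> in Taylor's estimate and makes the bound valid for every \<open>t\<close>.
\<close>

lemma char_sum_accompanying_bound:
  assumes fin: "finite I"
    and indep: "indep_vars (\<lambda>_. borel) X I"
    and rv: "\<And>k. k \<in> I \<Longrightarrow> random_variable borel (X k)"
    and sq: "\<And>k. k \<in> I \<Longrightarrow> integrable M (\<lambda>\<omega>. (X k \<omega>)\<^sup>2)"
    and mean: "\<And>k. k \<in> I \<Longrightarrow> expectation (X k) = 0"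
    and m: "\<And>k. k \<in> I \<Longrightarrow> expectation (\<lambda>\<omega>. (X k \<omega>)\<^sup>2) \<le> m"
  shows "cmod (char (distr M borel (\<lambda>\<omega>. \<Sum>k\<in>I. X k \<omega>)) t
      - exp (\<Sum>k\<in>I. char (distr M borel (X k)) t - 1))
    \<le> 4 * exp 2 * t ^ 4 * m * (\<Sum>k\<in>I. expectation (\<lambda>\<omega>. (X k \<omega>)\<^sup>2))"
proof -
  define \<phi> where "\<phi> k = char (distr M borel (X k)) t" for k
  define v where "v k = expectation (\<lambda>\<omega>. (X k \<omega>)\<^sup>2)" for k
  have \<phi>1: "cmod (\<phi> k) \<le> 1" if "k \<in> I" for k
    unfolding \<phi>_def
    by (intro real_distribution.cmod_char_le_1 real_distribution_distr rv that)
  have Re_\<phi>: "\<bar>Re (\<phi> k)\<bar> \<le> 1" if "k \<in> I" for k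
    using abs_Re_le_cmod[of "\<phi> k"] \<phi>1[OF that] by linarith
  have one: "cmod (\<phi> k - exp (\<phi> k - 1)) \<le> 4 * exp 2 * t ^ 4 * m * v k" if k: "k \<in> I" for k
  proof -
    have v: "0 \<le> v k" "v k \<le> m"
      using m[OF k] by (auto simp: v_def)
    have "cmod (\<phi> k - exp (\<phi> k - 1)) = cmod (exp (\<phi> k - 1) - (\<Sum>j\<le>1. (\<phi> k - 1) ^ j / fact j))"
      by (simp add: norm_minus_commute)
    also have "\<dots> \<le> exp \<bar>Re (\<phi> k - 1)\<bar> * cmod (\<phi> k - 1) ^ 2"
      using Taylor_exp[of "\<phi> k - 1" 1] by (simp only: Suc_1 fact_1 div_by_1)
    also have "\<dots> \<le> exp 2 * (2 * t\<^sup>2 * v k) ^ 2"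
      using char_minus_one_bound[OF rv sq mean, OF k k k, of t] Re_\<phi>[OF k]
      by (intro mult_mono power_mono) (auto simp: \<phi>_def v_def)
    also have "\<dots> = 4 * exp 2 * t ^ 4 * (v k * v k)"
      by (simp add: power2_eq_square power4_eq_xxxx)
    also have "\<dots> \<le> 4 * exp 2 * t ^ 4 * (m * v k)"
      using v by (intro mult_left_mono mult_right_mono) auto
    finally show ?thesis
      by (simp add: mult.assoc)
  qed
  have "char (distr M borel (\<lambda>\<omega>. \<Sum>k\<in>I. X k \<omega>)) t = (\<Prod>k\<in>I. \<phi> k)"
    unfolding \<phi>_def by (rule char_distr_sum[OF indep])
  moreover have "exp (\<Sum>k\<in>I. \<phi> k - 1) = (\<Prod>k\<in>I. exp (\<phi> k - 1))"
    by (rule exp_sum[OF fin])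
  moreover have "cmod ((\<Prod>k\<in>I. \<phi> k) - (\<Prod>k\<in>I. exp (\<phi> k - 1))) \<le> (\<Sum>k\<in>I. cmod (\<phi> k - exp (\<phi> k - 1)))"
  proof (rule norm_prod_diff)
    show "cmod (exp (\<phi> k - 1)) \<le> 1" if "k \<in> I" for k
      using Re_\<phi>[OF that] by simp
  qed (rule \<phi>1)
  moreover have "\<dots> \<le> (\<Sum>k\<in>I. 4 * exp 2 * t ^ 4 * m * v k)"
    by (rule sum_mono) (rule one)
  moreover have "\<dots> = 4 * exp 2 * t ^ 4 * m * (\<Sum>k\<in>I. v k)"
    by (simp only: sum_distrib_left)
  ultimately have "cmod (char (distr M borel (\<lambda>\<omega>. \<Sum>k\<in>I. X k \<omega>)) t - exp (\<Sum>k\<in>I. \<phi> k - 1))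
      \<le> 4 * exp 2 * t ^ 4 * m * (\<Sum>k\<in>I. v k)"
    by (simp only: )
  then show ?thesis
    by (simp only: \<phi>_def v_def)
qed

end

section \<open>The Lindeberg--Feller theorem\<close>

theorem lindeberg_feller:
  fixes M :: "nat \<Rightarrow> 'a measure" and I :: "nat \<Rightarrow> 'i set" and X :: "nat \<Rightarrow> 'i \<Rightarrow> 'a \<Rightarrow> real"
  assumes prob: "\<And>n. prob_space (M n)"
    and fin: "\<And>n. finite (I n)"
    and rv: "\<And>n k. k \<in> I n \<Longrightarrow> X n k \<in> borel_measurable (M n)"
    and sq: "\<And>n k. k \<in> I n \<Longrightarrow> integrable (M n) (\<lambda>\<omega>. (X n k \<omega>)\<^sup>2)"
    and mean: "\<And>n k. k \<in> I n \<Longrightarrow> prob_space.expectation (M n) (X n k) = 0"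
    and indep: "\<And>n. prob_space.indep_vars (M n) (\<lambda>_. borel) (X n) (I n)"
    and var_sum: "\<And>n. (\<Sum>k\<in>I n. prob_space.expectation (M n) (\<lambda>\<omega>. (X n k \<omega>)\<^sup>2)) = 1"
  shows "weak_conv_m (\<lambda>n. distr (M n) borel (\<lambda>\<omega>. \<Sum>k\<in>I n. X n k \<omega>)) std_normal_distribution \<and>
      (\<lambda>n. Max ((\<lambda>k. prob_space.expectation (M n) (\<lambda>\<omega>. (X n k \<omega>)\<^sup>2)) ` I n)) \<longlonglongrightarrow> 0
    \<longleftrightarrow> (\<forall>\<epsilon>>0. (\<lambda>n. \<Sum>k\<in>I n. tail_second_moment (M n) (X n k) \<epsilon>) \<longlonglongrightarrow> 0)"
    (is "?clt \<and> ?neg \<longleftrightarrow> ?lind")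
proof -
  define v where "v n k = prob_space.expectation (M n) (\<lambda>\<omega>. (X n k \<omega>)\<^sup>2)" for n k
  define m where "m n = Max (v n ` I n)" for n
  define g where "g n \<epsilon> = (\<Sum>k\<in>I n. tail_second_moment (M n) (X n k) \<epsilon>)" for n \<epsilon>
  define \<phi> where "\<phi> n k t = char (distr (M n) borel (X n k)) t" for n k t
  define \<Phi> where "\<Phi> n t = char (distr (M n) borel (\<lambda>\<omega>. \<Sum>k\<in>I n. X n k \<omega>)) t" for n t
  define \<psi> where "\<psi> n t = (\<Sum>k\<in>I n. \<phi> n k t - 1)" for n t
  have sum_v: "(\<Sum>k\<in>I n. v n k) = 1" for n
    using var_sum[of n] by (simp add: v_def)
  have I_ne: "I n \<noteq> {}" for n
    using sum_v[of n] by auto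
  have v_le_m: "v n k \<le> m n" if "k \<in> I n" for n k
    unfolding m_def using fin that by (intro Max_ge) auto
  have v_nonneg: "0 \<le> v n k" for n k
    by (simp add: v_def)
  have m_attained: "\<exists>k\<in>I n. m n = v n k" for n
    using Max_in[of "v n ` I n"] fin[of n] I_ne[of n] unfolding m_def by (auto simp: image_iff)
  have tail_nonneg: "0 \<le> tail_second_moment (M n) (X n k) \<epsilon>" if "k \<in> I n" for n k \<epsilon>
    by (rule prob_space.tail_second_moment_nonneg[OF prob rv sq]) (use that in auto)
  have g_nonneg: "0 \<le> g n \<epsilon>" for n \<epsilon>
    unfolding g_def by (intro sum_nonneg tail_nonneg)
  have rv_sum: "(\<lambda>\<omega>. \<Sum>k\<in>I n. X n k \<omega>) \<in> borel_measurable (M n)" for n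
    by (intro borel_measurable_sum rv)
  have dist_sum: "real_distribution (distr (M n) borel (\<lambda>\<omega>. \<Sum>k\<in>I n. X n k \<omega>))" for n
    by (intro prob_space.real_distribution_distr prob rv_sum)
  have accompanying: "(\<lambda>n. \<Phi> n t - exp (\<psi> n t)) \<longlonglongrightarrow> 0" if "m \<longlonglongrightarrow> 0" for t
  proof (rule Lim_null_comparison)
    show "\<forall>\<^sub>F n in sequentially. cmod (\<Phi> n t - exp (\<psi> n t)) \<le> 4 * exp 2 * t ^ 4 * m n"
    proof (intro always_eventually allI)
      fix n
      show "cmod (\<Phi> n t - exp (\<psi> n t)) \<le> 4 * exp 2 * t ^ 4 * m n"
        using prob_space.char_sum_accompanying_bound[OF prob fin indep, of n "m n" t]
          rv sq mean v_le_m var_sum[of n]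
        by (simp add: \<Phi>_def \<psi>_def \<phi>_def v_def)
    qed
    have "(\<lambda>n. 4 * exp 2 * t ^ 4 * m n) \<longlonglongrightarrow> 4 * exp 2 * t ^ 4 * 0"
      by (intro tendsto_intros that)
    then show "(\<lambda>n. 4 * exp 2 * t ^ 4 * m n) \<longlonglongrightarrow> 0"
      by simp
  qed
  have \<psi>_plus: "\<psi> n t + complex_of_real (t\<^sup>2 / 2)
      = (\<Sum>k\<in>I n. \<phi> n k t - 1 + complex_of_real (t\<^sup>2 * v n k / 2))" for n t
  proof -
    have "t\<^sup>2 / 2 = (\<Sum>k\<in>I n. t\<^sup>2 * v n k / 2)"
      using sum_v[of n] by (simp add: sum_distrib_left[symmetric] sum_divide_distrib[symmetric])
    then have "complex_of_real (t\<^sup>2 / 2) = (\<Sum>k\<in>I n. complex_of_real (t\<^sup>2 * v n k / 2))"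
      by (simp only: of_real_sum)
    then show ?thesis
      unfolding \<psi>_def by (simp only: sum.distrib)
  qed
  have "?clt" and "m \<longlonglongrightarrow> 0" if lind: "\<And>\<epsilon>. \<epsilon> > 0 \<Longrightarrow> (\<lambda>n. g n \<epsilon>) \<longlonglongrightarrow> 0"
  proof -
    show m0: "m \<longlonglongrightarrow> 0"
    proof (rule tendsto_zero_by_approximation[OF lind])
      show "((\<lambda>\<epsilon>::real. \<epsilon>\<^sup>2) \<longlongrightarrow> 0) (at_right 0)"
        by (auto intro!: tendsto_eq_intros)
      show "norm (m n) \<le> \<epsilon>\<^sup>2 + 1 * g n \<epsilon>" for n \<epsilon>
      proof -
        obtain k where k: "k \<in> I n" "m n = v n k"
          using m_attained by blast
        have "v n k \<le> \<epsilon>\<^sup>2 + tail_second_moment (M n) (X n k) \<epsilon>"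
          unfolding v_def
          by (rule prob_space.second_moment_le_tail[OF prob rv sq]) (use k in auto)
        also have "tail_second_moment (M n) (X n k) \<epsilon> \<le> g n \<epsilon>"
          unfolding g_def using fin k tail_nonneg by (intro member_le_sum) auto
        finally show ?thesis
          using k v_nonneg[of n k] by simp
      qed
    qed
    show ?clt
    proof (rule levy_continuity[OF dist_sum real_dist_normal_dist])
      fix t
      have "(\<lambda>n. \<psi> n t + complex_of_real (t\<^sup>2 / 2)) \<longlonglongrightarrow> 0"
      proof (rule tendsto_zero_by_approximation[OF lind])
        show "((\<lambda>\<epsilon>. \<bar>t\<bar> ^ 3 * \<epsilon> / 6) \<longlongrightarrow> 0) (at_right 0)"
          by (auto intro!: tendsto_eq_intros)
        show "cmod (\<psi> n t + complex_of_real (t\<^sup>2 / 2)) \<le> \<bar>t\<bar> ^ 3 * \<epsilon> / 6 + t\<^sup>2 * g n \<epsilon>"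
          if "\<epsilon> > 0" for n \<epsilon>
        proof -
          have "cmod (\<psi> n t + complex_of_real (t\<^sup>2 / 2))
              \<le> (\<Sum>k\<in>I n. \<bar>t\<bar> ^ 3 * \<epsilon> / 6 * v n k + t\<^sup>2 * tail_second_moment (M n) (X n k) \<epsilon>)"
            unfolding \<psi>_plus
          proof (rule sum_norm_le)
            fix k assume "k \<in> I n"
            then show "cmod (\<phi> n k t - 1 + complex_of_real (t\<^sup>2 * v n k / 2))
                \<le> \<bar>t\<bar> ^ 3 * \<epsilon> / 6 * v n k + t\<^sup>2 * tail_second_moment (M n) (X n k) \<epsilon>"
              unfolding \<phi>_def v_def
              by (intro prob_space.char_second_order_tail_bound prob rv sq mean that)
          qed
          also have "\<dots> = \<bar>t\<bar> ^ 3 * \<epsilon> / 6 * (\<Sum>k\<in>I n. v n k) + t\<^sup>2 * g n \<epsilon>"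
            by (simp only: sum.distrib sum_distrib_left g_def)
          finally show ?thesis
            by (simp add: sum_v)
        qed
      qed
      from tendsto_diff[OF this tendsto_const[of "complex_of_real (t\<^sup>2 / 2)"]]
      have "(\<lambda>n. \<psi> n t) \<longlonglongrightarrow> - complex_of_real (t\<^sup>2 / 2)"
        by simp
      then have "(\<lambda>n. exp (\<psi> n t)) \<longlonglongrightarrow> exp (- complex_of_real (t\<^sup>2 / 2))"
        by (rule tendsto_exp)
      from tendsto_add[OF accompanying[OF m0, of t] this]
      show "(\<lambda>n. char (distr (M n) borel (\<lambda>\<omega>. \<Sum>k\<in>I n. X n k \<omega>)) t)
          \<longlonglongrightarrow> char std_normal_distribution t"
        by (simp add: char_std_normal_distribution exp_of_real[symmetric] \<Phi>_def)
    qed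
  qed
  moreover have "(\<lambda>n. g n \<epsilon>) \<longlonglongrightarrow> 0" if clt: ?clt and m0: "m \<longlonglongrightarrow> 0" and \<epsilon>: "\<epsilon> > 0" for \<epsilon>
  proof -
    \<comment> \<open>Any \<open>t > 2/\<epsilon>\<close> makes \<open>t\<^sup>2/2 - 2/\<epsilon>\<^sup>2\<close> positive; this one gives \<open>6/\<epsilon>\<^sup>2\<close>.\<close>
    define t where "t = 4 / \<epsilon>"
    have "(\<lambda>n. \<Phi> n t) \<longlonglongrightarrow> exp (- complex_of_real (t\<^sup>2 / 2))"
      using levy_continuity1[OF dist_sum real_dist_normal_dist clt, of t]
      by (simp add: \<Phi>_def char_std_normal_distribution exp_of_real[symmetric])
    from tendsto_diff[OF this accompanying[OF m0, of t]]
    have "(\<lambda>n. exp (\<psi> n t)) \<longlonglongrightarrow> exp (- complex_of_real (t\<^sup>2 / 2))"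
      by simp
    from tendsto_norm[OF this] have "(\<lambda>n. exp (Re (\<psi> n t))) \<longlonglongrightarrow> exp (- (t\<^sup>2 / 2))"
      by simp
    from tendsto_ln[OF this] have "(\<lambda>n. Re (\<psi> n t)) \<longlonglongrightarrow> - (t\<^sup>2 / 2)"
      by simp
    from tendsto_add[OF this tendsto_const[of "t\<^sup>2 / 2"]]
    have "(\<lambda>n. Re (\<psi> n t) + t\<^sup>2 / 2) \<longlonglongrightarrow> 0"
      by simp
    from tendsto_mult_left[OF this, of "\<epsilon>\<^sup>2 / 6"]
    have lim: "(\<lambda>n. \<epsilon>\<^sup>2 / 6 * (Re (\<psi> n t) + t\<^sup>2 / 2)) \<longlonglongrightarrow> 0"
      by simp
    have "g n \<epsilon> \<le> \<epsilon>\<^sup>2 / 6 * (Re (\<psi> n t) + t\<^sup>2 / 2)" for n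
    proof -
      have "6 / \<epsilon>\<^sup>2 * g n \<epsilon> = (t\<^sup>2 / 2 - 2 / \<epsilon>\<^sup>2) * g n \<epsilon>"
        by (simp add: t_def power_divide field_simps)
      also have "\<dots> = (\<Sum>k\<in>I n. (t\<^sup>2 / 2 - 2 / \<epsilon>\<^sup>2) * tail_second_moment (M n) (X n k) \<epsilon>)"
        by (simp only: g_def sum_distrib_left)
      also have "\<dots> \<le> (\<Sum>k\<in>I n. Re (\<phi> n k t) - 1 + t\<^sup>2 * v n k / 2)"
        unfolding \<phi>_def v_def
        by (intro sum_mono prob_space.tail_le_char_deviation prob rv sq \<epsilon>)
      also have "\<dots> = Re (\<psi> n t + complex_of_real (t\<^sup>2 / 2))"
        unfolding \<psi>_plus by simp
      finally show ?thesis
        using \<epsilon> by (simp add: field_simps)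
    qed
    then show ?thesis
      using g_nonneg by (intro tendsto_sandwich[OF _ _ tendsto_const lim]) auto
  qed
  ultimately show ?thesis
    unfolding m_def g_def v_def by blast
qed

theorem theorem4:
  fixes M :: "nat \<Rightarrow> 'a measure"
    and K :: "nat \<Rightarrow> nat"
    and X :: "nat \<Rightarrow> nat \<Rightarrow> 'a \<Rightarrow> real"
    and S :: "nat \<Rightarrow> 'a \<Rightarrow> real"
    and F :: "nat \<Rightarrow> nat \<Rightarrow> real \<Rightarrow> real"
    and g :: "nat \<Rightarrow> real \<Rightarrow> real"
  assumes prob: "\<And>n. n \<ge> 1 \<Longrightarrow> prob_space (M n)"
    and K_lim: "filterlim K at_top sequentially"
    and rv: "\<And>n k. n \<ge> 1 \<Longrightarrow> k \<in> {1..K n} \<Longrightarrow> X k n \<in> borel_measurable (M n)"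
    and square_integrable:
      "\<And>n k. n \<ge> 1 \<Longrightarrow> k \<in> {1..K n} \<Longrightarrow> integrable (M n) (\<lambda>\<omega>. (X k n \<omega>)\<^sup>2)"
    and centered:
      "\<And>n k. n \<ge> 1 \<Longrightarrow> k \<in> {1..K n} \<Longrightarrow> prob_space.expectation (M n) (X k n) = 0"
    and indep:
      "\<And>n. n \<ge> 1 \<Longrightarrow> prob_space.indep_vars (M n) (\<lambda>_. borel) (\<lambda>k. X k n) {1..K n}"
    and var_sum:
      "\<And>n. n \<ge> 1 \<Longrightarrow> (\<Sum>k=1..K n. prob_space.variance (M n) (X k n)) = 1"
  defines "S \<equiv> \<lambda>n \<omega>. \<Sum>k=1..K n. X k n \<omega>"
    and "F \<equiv> \<lambda>k n. cdf (distr (M n) borel (X k n))"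
    and "g \<equiv> \<lambda>n \<epsilon>. \<Sum>k=1..K n. (LINT x:{x. \<bar>x\<bar> \<ge> \<epsilon>}|interval_measure (F k n). x\<^sup>2)"
  shows "(weak_conv_m (\<lambda>n. distr (M n) borel (S n)) std_normal_distribution \<and>
          (\<lambda>n. Max ((\<lambda>k. prob_space.variance (M n) (X k n)) ` {1..K n})) \<longlonglongrightarrow> 0)
         \<longleftrightarrow> (\<forall>\<epsilon>>0. (\<lambda>n. g n \<epsilon>) \<longlonglongrightarrow> 0)"
proof -
  \<comment> \<open>The hypotheses say nothing about row 0, so the array is shifted by one row; this changes none of the limits.\<close>
  have var: "prob_space.variance (M n) (X k n) = (\<integral>\<omega>. (X k n \<omega>)\<^sup>2 \<partial>M n)"
    if "n \<ge> 1" "k \<in> {1..K n}" for n k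
    using centered[OF that] by simp
  have "(weak_conv_m (\<lambda>n. distr (M (Suc n)) borel (\<lambda>\<omega>. \<Sum>k\<in>{1..K (Suc n)}. X k (Suc n) \<omega>))
          std_normal_distribution \<and>
        (\<lambda>n. Max ((\<lambda>k. \<integral>\<omega>. (X k (Suc n) \<omega>)\<^sup>2 \<partial>M (Suc n)) ` {1..K (Suc n)})) \<longlonglongrightarrow> 0)
      \<longleftrightarrow> (\<forall>\<epsilon>>0. (\<lambda>n. \<Sum>k\<in>{1..K (Suc n)}. tail_second_moment (M (Suc n)) (X k (Suc n)) \<epsilon>) \<longlonglongrightarrow> 0)"
  proof (rule lindeberg_feller)
    show "(\<Sum>k\<in>{1..K (Suc n)}. \<integral>\<omega>. (X k (Suc n) \<omega>)\<^sup>2 \<partial>M (Suc n)) = 1" for n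
      using var_sum[of "Suc n"] var[of "Suc n"] by simp
  qed (use prob rv square_integrable centered indep in auto)
  moreover have "weak_conv_m (\<lambda>n. distr (M n) borel (S n)) std_normal_distribution \<longleftrightarrow>
      weak_conv_m (\<lambda>n. distr (M (Suc n)) borel (\<lambda>\<omega>. \<Sum>k\<in>{1..K (Suc n)}. X k (Suc n) \<omega>))
        std_normal_distribution"
    unfolding weak_conv_m_def weak_conv_def S_def
    by (subst filterlim_sequentially_Suc[symmetric]) (rule refl)
  moreover have "(\<lambda>n. Max ((\<lambda>k. prob_space.variance (M n) (X k n)) ` {1..K n})) \<longlonglongrightarrow> 0 \<longleftrightarrow>
      (\<lambda>n. Max ((\<lambda>k. \<integral>\<omega>. (X k (Suc n) \<omega>)\<^sup>2 \<partial>M (Suc n)) ` {1..K (Suc n)})) \<longlonglongrightarrow> 0"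
  proof -
    have "(\<lambda>k. prob_space.variance (M (Suc n)) (X k (Suc n))) ` {1..K (Suc n)}
        = (\<lambda>k. \<integral>\<omega>. (X k (Suc n) \<omega>)\<^sup>2 \<partial>M (Suc n)) ` {1..K (Suc n)}" for n
      by (intro image_cong refl var) auto
    then show ?thesis
      by (subst filterlim_sequentially_Suc[symmetric]) (simp only:)
  qed
  moreover have "(\<lambda>n. g n \<epsilon>) \<longlonglongrightarrow> 0 \<longleftrightarrow>
      (\<lambda>n. \<Sum>k\<in>{1..K (Suc n)}. tail_second_moment (M (Suc n)) (X k (Suc n)) \<epsilon>) \<longlonglongrightarrow> 0" for \<epsilon>
  proof -
    have "g (Suc n) \<epsilon> = (\<Sum>k\<in>{1..K (Suc n)}. tail_second_moment (M (Suc n)) (X k (Suc n)) \<epsilon>)" for n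
      unfolding g_def F_def
      by (intro sum.cong refl prob_space.tail_second_moment_eq_interval_measure prob rv) auto
    then show ?thesis
      by (subst filterlim_sequentially_Suc[symmetric]) simp
  qed
  ultimately show ?thesis
    by simp
qed

end
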